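(* Let $\mathcal{T}_0=(A_0,B_0,C_0,D_0)$ be a quadruple of non-coplanar points of the unit sphere $\mathcal{S}\subset\mathbb{R}^3$ with center $O$, and let $(\mathcal{T}_n)_{n\ge0}$ be the sequence of quadruples produced from it by the iteration described in the context. Then the sequences $(\mathcal{T}_{2i})_{i\in\mathbb{N}}$ and $(\mathcal{T}_{2i+1})_{i\in\mathbb{N}}$ are well defined and converge in $\mathcal{S}^4$ to two non-planar isosceles tetrahedra that are symmetric to each other with respect to $O$ (corresponding vertices are antipodal). Moreover the convergence of both sequences is with at least geometric speed.
   Context: Iteration: given $\mathcal{T}_n=(A_n,B_n,C_n,D_n)\in\mathcal{S}^4$ with centroid $G_n$, $\mathcal{T}_{n+1}=(A_{n+1},B_{n+1},C_{n+1},D_{n+1})$, where $A_{n+1}$ is the second intersection point of the line $G_nA_n$ with $\mathcal{S}$ (other than $A_n$), and similarly for $B_{n+1},C_{n+1},D_{n+1}$. A non-planar tetrahedron $(A,B,C,D)$ is isosceles if opposite edges have equal lengths: $AB=CD$, $AC=BD$, $AD=BC$. A sequence $(x_i)$ converges to $x$ with at least geometric speed if there is $q\in(0,1)$ such that $\|x_i-x\|=O(q^i)$. *)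

theory Defs
  imports "HOL-Analysis.Analysis" "HOL-Library.Landau_Symbols"
begin

type_synonym point = "real ^ 3"

text \<open>A quadruple \<open>(A, B, C, D)\<close> is a vector with components \<open>T $ 1, T $ 2, T $ 3, T $ 4\<close>.
  In the index type \<open>4\<close> the numeral \<open>4\<close> equals \<open>0\<close>, so these are all the components.\<close>

type_synonym quadruple = "point ^ 4"

text \<open>The center \<open>O\<close> of the unit sphere is placed at the origin.\<close>

abbreviation unit_sphere :: "point set" where
  "unit_sphere \<equiv> sphere 0 1"

definition sphere_quadruples :: "quadruple set" where
  "sphere_quadruples = {T. \<forall>k. T $ k \<in> unit_sphere}"

definition vertices :: "quadruple \<Rightarrow> point set" where
  "vertices T = range (($) T)"

definition centroid :: "quadruple \<Rightarrow> point" where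
  "centroid T = (1 / 4) *\<^sub>R (\<Sum>k\<in>UNIV. T $ k)"

definition is_second_intersection :: "point \<Rightarrow> point \<Rightarrow> point \<Rightarrow> bool" where
  "is_second_intersection G P X \<longleftrightarrow> X \<in> affine hull {G, P} \<and> X \<in> unit_sphere \<and> X \<noteq> P"

text \<open>The description operator is meaningful only for quadruples satisfying
  \<open>step_well_defined\<close> below: every line from the centroid to a vertex is determined (its two
  points are distinct), and it has exactly one further intersection point with the sphere.\<close>

definition second_intersection :: "point \<Rightarrow> point \<Rightarrow> point" where
  "second_intersection G P = (THE X. is_second_intersection G P X)"

definition step :: "quadruple \<Rightarrow> quadruple" where
  "step T = (\<chi> k. second_intersection (centroid T) (T $ k))"

definition step_well_defined :: "quadruple \<Rightarrow> bool" where
  "step_well_defined T \<longleftrightarrow>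
     (\<forall>k. centroid T \<noteq> T $ k \<and> (\<exists>!X. is_second_intersection (centroid T) (T $ k) X))"

definition iterate :: "quadruple \<Rightarrow> nat \<Rightarrow> quadruple" where
  "iterate T n = (step ^^ n) T"

definition isosceles :: "quadruple \<Rightarrow> bool" where
  "isosceles T \<longleftrightarrow>
     \<not> coplanar (vertices T) \<and>
     dist (T $ 1) (T $ 2) = dist (T $ 3) (T $ 4) \<and>
     dist (T $ 1) (T $ 3) = dist (T $ 2) (T $ 4) \<and>
     dist (T $ 1) (T $ 4) = dist (T $ 2) (T $ 3)"

definition converges_geometrically :: "(nat \<Rightarrow> 'a::real_normed_vector) \<Rightarrow> 'a \<Rightarrow> bool" where
  "converges_geometrically x l \<longleftrightarrow> (\<exists>q\<in>{0<..<1::real}. (\<lambda>i. norm (x i - l)) \<in> O(\<lambda>i. q ^ i))"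

end

theory Submission
  imports Defs
begin

text \<open>Let \<open>G\<close> be the centroid of \<open>A\<^sub>1, \<dots>, A\<^sub>4\<close> and \<open>d\<^sub>k = A\<^sub>k - G\<close>. Solving the quadratic equation of the line
  and the sphere shows that the new vertex is the mirror image of \<open>A\<^sub>k\<close> in the plane through the
  origin orthogonal to \<open>d\<^sub>k\<close>. Writing \<open>P\<^sub>k\<close> for the orthogonal projection onto the line of \<open>d\<^sub>k\<close>,
  this means \<open>A\<^sub>k' = - A\<^sub>k + 2 (G - P\<^sub>k G)\<close> (lemma \<open>step_add_self\<close>), from which two things follow.

  The vertex \<open>A\<^sub>k'\<close> is within \<open>2 |G|\<close> of the antipode of \<open>A\<^sub>k\<close>. So the quadruples taken with
  alternating signs form a Cauchy sequence with geometric rate as soon as the centroids tend to \<open>0\<close>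
  geometrically.

  Averaging over \<open>k\<close> gives the exact formula \<open>G' = G - (1/2) \<Sum> P\<^sub>k G\<close> (lemma \<open>centroid_step\<close>), whose
  right-hand side is linear in \<open>G\<close> once the \<open>d\<^sub>k\<close> are given. The linear map strictly shortens every
  nonzero vector unless the vertices are coplanar (lemma \<open>norm_diff_half_sum_projections_less\<close>).

  A uniform contraction factor now comes from compactness, provided that the tetrahedra do not
  flatten. They do not: their volume never decreases. Indeed \<open>A\<^sub>k' - G\<close> is \<open>d\<^sub>k\<close> scaled by
  \<open>- p / |d\<^sub>k|\<^sup>2\<close>, where \<open>p = 1 - |G|\<^sup>2\<close> is minus the power of \<open>G\<close> with respect to the sphere, and since
  the mean of the four numbers \<open>|d\<^sub>k|\<^sup>2\<close> is also \<open>p\<close>, the volume is multiplied by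
  \<open>p\<^sup>4 / \<Prod> |d\<^sub>k|\<^sup>2\<close>, which is at least \<open>1\<close> by the inequality of the arithmetic and geometric means
  (lemma \<open>abs_signed_volume_step\<close>).

  The limit therefore has nonzero volume and centroid \<open>0\<close>. For unit vectors, \<open>A + B = - (C + D)\<close> forces
  \<open>|A - B| = |C - D|\<close>, so the limit is isosceles.\<close>

section \<open>Coplanarity and volume\<close>

text \<open>Six times the oriented volume of the tetrahedron.\<close>

definition signed_volume :: "quadruple \<Rightarrow> real" where
  "signed_volume T = (T $ 1 - T $ 4) \<bullet> cross3 (T $ 2 - T $ 4) (T $ 3 - T $ 4)"

text \<open>Turns a linear dependence between the edge vectors at \<open>d\<close> into membership in a plane, so that a
  vanishing determinant yields coplanarity.\<close>

lemma in_affine_hull_3_of_dependence: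
  fixes a b c d :: "'a::real_vector"
  assumes "\<alpha> *\<^sub>R (a - d) + \<beta> *\<^sub>R (b - d) + \<gamma> *\<^sub>R (c - d) = 0" and "\<alpha> \<noteq> 0"
  shows "a \<in> affine hull {b, c, d}"
proof -
  have "\<alpha> *\<^sub>R (a - d) = - (\<beta> *\<^sub>R (b - d) + \<gamma> *\<^sub>R (c - d))"
    unfolding eq_neg_iff_add_eq_0 using assms(1) by (simp only: add.assoc)
  then have "(1 / \<alpha>) *\<^sub>R (\<alpha> *\<^sub>R (a - d)) = (1 / \<alpha>) *\<^sub>R - (\<beta> *\<^sub>R (b - d) + \<gamma> *\<^sub>R (c - d))"
    by (rule arg_cong)
  then have "a - d = (- \<beta> / \<alpha>) *\<^sub>R (b - d) + (- \<gamma> / \<alpha>) *\<^sub>R (c - d)"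
    using assms(2) by (simp add: scaleR_add_right scaleR_diff_right)
  then have "a = (- \<beta> / \<alpha>) *\<^sub>R b + (- \<gamma> / \<alpha>) *\<^sub>R c + (1 - - \<beta> / \<alpha> - - \<gamma> / \<alpha>) *\<^sub>R d"
    unfolding scaleR_diff_left scaleR_diff_right by (simp add: algebra_simps)
  moreover have "(- \<beta> / \<alpha>) + (- \<gamma> / \<alpha>) + (1 - - \<beta> / \<alpha> - - \<gamma> / \<alpha>) = 1"
    by simp
  ultimately show ?thesis
    unfolding affine_hull_3 by blast
qed

text \<open>If the determinant of the three edge vectors at the fourth vertex vanishes, they are linearly
  dependent, and the vertex whose edge has a nonzero coefficient lies in the plane of the others.\<close>

lemma coplanar_if_signed_volume_0:
  assumes "signed_volume T = 0"
  shows "coplanar (vertices T)"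
proof -
  let ?x = "T $ 1 - T $ 4" and ?y = "T $ 2 - T $ 4" and ?z = "T $ 3 - T $ 4"
  have vs: "vertices T = {T $ 1, T $ 2, T $ 3, T $ 4}"
    by (auto simp: vertices_def UNIV_4)
  let ?M = "vector [?x, ?y, ?z] :: real^3^3"
  have "det ?M = 0"
    using assms by (simp add: signed_volume_def dot_cross_det)
  then have "\<not> (\<exists>B. ?M ** B = mat 1)"
    using invertible_det_nz[of ?M] invertible_right_inverse by blast
  then obtain c where c0: "(\<Sum>i\<in>UNIV. c i *s row i ?M) = 0" and c: "\<exists>i. c i \<noteq> 0"
    unfolding matrix_right_invertible_independent_rows by blast
  have dep: "c 1 *\<^sub>R ?x + c 2 *\<^sub>R ?y + c 3 *\<^sub>R ?z = 0"
    using c0 by (simp add: sum_3 row_def vec_eq_iff vector_def right_diff_distrib)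
  have cop: "coplanar (vertices T)" if "a \<in> affine hull {b, c', d}" "vertices T = {a, b, c', d}" for a b c' d
    unfolding coplanar_def using that hull_subset[of "{b, c', d}" affine] by (metis insert_subset)
  consider "c 1 \<noteq> 0" | "c 2 \<noteq> 0" | "c 3 \<noteq> 0"
    using c by (metis exhaust_3)
  then show ?thesis
  proof cases
    case 1
    from in_affine_hull_3_of_dependence[OF dep this] vs show ?thesis
      by (rule cop)
  next
    case 2
    have "c 2 *\<^sub>R ?y + c 1 *\<^sub>R ?x + c 3 *\<^sub>R ?z = 0"
      using dep by (simp add: add_ac)
    from in_affine_hull_3_of_dependence[OF this 2] show ?thesis
      by (rule cop) (auto simp: vs)
  next
    case 3
    have "c 3 *\<^sub>R ?z + c 1 *\<^sub>R ?x + c 2 *\<^sub>R ?y = 0"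
      using dep by (simp add: add_ac)
    from in_affine_hull_3_of_dependence[OF this 3] show ?thesis
      by (rule cop) (auto simp: vs)
  qed
qed

text \<open>In a plane through \<open>u, v, w\<close> all edge vectors are combinations of the two vectors \<open>v - u\<close> and
  \<open>w - u\<close>, and the triple product is alternating.\<close>

lemma signed_volume_0_if_coplanar:
  assumes "coplanar (vertices T)"
  shows "signed_volume T = 0"
proof -
  obtain u v w where "vertices T \<subseteq> affine hull {u, v, w}"
    using assms coplanar_def by blast
  then have "T $ k \<in> affine hull {u, v, w}" for k
    unfolding vertices_def by (meson rangeI subsetD)
  then have "\<exists>a b c. T $ k = a *\<^sub>R u + b *\<^sub>R v + c *\<^sub>R w \<and> a + b + c = 1" for k
    unfolding affine_hull_3 by blast
  then have "\<forall>k. \<exists>a b c. T $ k = a *\<^sub>R u + b *\<^sub>R v + c *\<^sub>R w \<and> a + b + c = 1" ..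
  from choice[OF this] obtain a where
    "\<forall>k. \<exists>b c. T $ k = a k *\<^sub>R u + b *\<^sub>R v + c *\<^sub>R w \<and> a k + b + c = 1" ..
  from choice[OF this] obtain b where
    "\<forall>k. \<exists>c. T $ k = a k *\<^sub>R u + b k *\<^sub>R v + c *\<^sub>R w \<and> a k + b k + c = 1" ..
  from choice[OF this] obtain c where
    abc: "\<forall>k. T $ k = a k *\<^sub>R u + b k *\<^sub>R v + c k *\<^sub>R w \<and> a k + b k + c k = 1" ..
  have d: "T $ k - T $ 4 = (b k - b 4) *\<^sub>R (v - u) + (c k - c 4) *\<^sub>R (w - u)" for k
  proof -
    have a: "a j = 1 - b j - c j" for j
      using spec[OF abc, of j] by linarith
    have T: "T $ j = a j *\<^sub>R u + b j *\<^sub>R v + c j *\<^sub>R w" for j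
      using spec[OF abc, of j] by (rule conjunct1)
    show ?thesis
      unfolding T[of k] T[of 4] a[of k] a[of 4] by (simp add: algebra_simps)
  qed
  have "(x1 *\<^sub>R p + y1 *\<^sub>R q) \<bullet> cross3 (x2 *\<^sub>R p + y2 *\<^sub>R q) (x3 *\<^sub>R p + y3 *\<^sub>R q) = 0"
    for x1 x2 x3 y1 y2 y3 :: real and p q :: "real^3"
  proof -
    have "cross3 (x2 *\<^sub>R p + y2 *\<^sub>R q) (x3 *\<^sub>R p + y3 *\<^sub>R q)
        = (x2 * y3) *\<^sub>R cross3 p q + (y2 * x3) *\<^sub>R cross3 q p"
      by (simp add: cross_add_left cross_add_right cross_mult_left cross_mult_right mult_ac)
    then show ?thesis
      by (simp add: inner_add_left inner_add_right dot_cross_self)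
  qed
  then show ?thesis
    unfolding signed_volume_def d .
qed

lemma orthogonal_to_triple_imp_0:
  assumes "x \<bullet> cross3 y z \<noteq> 0" "n \<bullet> x = 0" "n \<bullet> y = 0" "n \<bullet> z = 0"
  shows "n = 0"
proof -
  have "(x \<bullet> cross3 y z) *\<^sub>R n
      = (n \<bullet> x) *\<^sub>R cross3 y z + (n \<bullet> y) *\<^sub>R cross3 z x + (n \<bullet> z) *\<^sub>R cross3 x y"
    by (simp add: cross3_simps forall_3)
  then show ?thesis using assms by simp
qed

section \<open>One step of the iteration\<close>

text \<open>Every point of the line is \<open>P - t (P - G)\<close>, and it lies on the sphere iff \<open>t\<close> solves a quadratic
  equation with the root \<open>0\<close> (the point \<open>P\<close>). The other root is nonzero because \<open>G\<close> is inside the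
  sphere, and it makes \<open>X\<close> the mirror image of \<open>P\<close> in the plane through the origin orthogonal to
  \<open>P - G\<close>.\<close>

lemma is_second_intersection_iff:
  assumes P: "norm P = 1" and G: "norm G < 1"
  shows "is_second_intersection G P X \<longleftrightarrow>
    X = P - (2 * (P \<bullet> (P - G)) / ((P - G) \<bullet> (P - G))) *\<^sub>R (P - G)"
proof -
  define d where "d = P - G"
  have PP: "P \<bullet> P = 1" using P by (simp add: dot_square_norm)
  have "P \<bullet> G < 1"
    using norm_cauchy_schwarz[of P G] P G by simp
  then have Pd: "P \<bullet> d > 0" by (simp add: d_def inner_diff_right PP)
  then have dd: "d \<bullet> d > 0" by auto
  have sph: "P - t *\<^sub>R d \<in> unit_sphere \<longleftrightarrow> t * (t * (d \<bullet> d) - 2 * (P \<bullet> d)) = 0" for t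
  proof -
    have "P - t *\<^sub>R d \<in> unit_sphere \<longleftrightarrow> (P - t *\<^sub>R d) \<bullet> (P - t *\<^sub>R d) = 1"
      by (simp add: norm_eq_1)
    also have "(P - t *\<^sub>R d) \<bullet> (P - t *\<^sub>R d) = 1 + t * (t * (d \<bullet> d) - 2 * (P \<bullet> d))"
      by (simp add: inner_diff_left inner_diff_right PP inner_commute algebra_simps)
    finally show ?thesis by simp
  qed
  have aff: "X \<in> affine hull {G, P} \<longleftrightarrow> (\<exists>t. X = P - t *\<^sub>R d)"
  proof
    assume "X \<in> affine hull {G, P}"
    then obtain u v where "X = u *\<^sub>R G + v *\<^sub>R P" "u + v = 1"
      unfolding affine_hull_2 by blast
    moreover from this have "v = 1 - u" by simp
    ultimately show "\<exists>t. X = P - t *\<^sub>R d"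
      by (intro exI[of _ u]) (simp add: d_def algebra_simps)
  next
    assume "\<exists>t. X = P - t *\<^sub>R d"
    then obtain t where "X = t *\<^sub>R G + (1 - t) *\<^sub>R P"
      by (auto simp: d_def algebra_simps)
    then show "X \<in> affine hull {G, P}"
      unfolding affine_hull_2 by force
  qed
  have "is_second_intersection G P X \<longleftrightarrow> (\<exists>t. X = P - t *\<^sub>R d \<and> t * (d \<bullet> d) = 2 * (P \<bullet> d))"
  proof -
    have "P - t *\<^sub>R d \<noteq> P \<longleftrightarrow> t \<noteq> 0" for t
      using dd by auto
    with sph Pd show ?thesis
      unfolding is_second_intersection_def aff by fastforce
  qed
  also have "\<dots> \<longleftrightarrow> X = P - (2 * (P \<bullet> d) / (d \<bullet> d)) *\<^sub>R d"
    using dd by (auto simp: field_simps)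
  finally show ?thesis unfolding d_def .
qed

definition offset :: "quadruple \<Rightarrow> 4 \<Rightarrow> point" where
  "offset T k = T $ k - centroid T"

lemma sum_offset: "(\<Sum>k\<in>UNIV. offset T k) = 0"
  by (simp add: offset_def centroid_def sum_subtractf)

lemma offset_4: "offset T 4 = - (offset T 1 + offset T 2 + offset T 3)"
  using sum_offset[of T] by (simp add: sum_4 add_eq_0_iff)

text \<open>The volume of a tetrahedron with vertices \<open>a x, b y, c z, d w\<close> when \<open>x + y + z + w = 0\<close>: it splits into
  four tetrahedra with apex at the origin, and the triples from \<open>x, y, z, w\<close> all span the same volume.
  With \<open>a = b = c = d = 1\<close> this expresses the volume by the offsets from the centroid, and with the
  scaling factors of a step it gives the volume of the next tetrahedron.\<close>

lemma triple_product_rescaled_differences: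
  fixes x y z :: "real^3"
  assumes w: "w = - (x + y + z)"
  shows "(a *\<^sub>R x - d *\<^sub>R w) \<bullet> cross3 (b *\<^sub>R y - d *\<^sub>R w) (c *\<^sub>R z - d *\<^sub>R w)
    = (a * b * c + a * b * d + a * c * d + b * c * d) * (x \<bullet> cross3 y z)"
proof -
  define s where "s = x + y + z"
  have s: "x \<bullet> cross3 y s = x \<bullet> cross3 y z" "x \<bullet> cross3 s z = x \<bullet> cross3 y z"
    "s \<bullet> cross3 y z = x \<bullet> cross3 y z"
    by (simp_all add: s_def cross_add_left cross_add_right inner_add_left inner_add_right dot_cross_self)
  have "cross3 (b *\<^sub>R y + d *\<^sub>R s) (c *\<^sub>R z + d *\<^sub>R s)
      = (b * c) *\<^sub>R cross3 y z + (b * d) *\<^sub>R cross3 y s + (c * d) *\<^sub>R cross3 s z"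
    by (simp add: cross_add_left cross_add_right cross_mult_left cross_mult_right scaleR_add_right mult_ac)
  then have "(a *\<^sub>R x + d *\<^sub>R s) \<bullet> cross3 (b *\<^sub>R y + d *\<^sub>R s) (c *\<^sub>R z + d *\<^sub>R s)
      = (a * b * c + a * b * d + a * c * d + b * c * d) * (x \<bullet> cross3 y z)"
    by (simp add: inner_add_left inner_add_right s dot_cross_self) (simp add: algebra_simps)
  moreover have "u - d *\<^sub>R w = u + d *\<^sub>R s" for u
    by (simp add: w s_def algebra_simps)
  ultimately show ?thesis
    by (simp only:)
qed

lemma signed_volume_offset:
  "signed_volume T = 4 * (offset T 1 \<bullet> cross3 (offset T 2) (offset T 3))"
proof -
  have "T $ k - T $ 4 = 1 *\<^sub>R offset T k - 1 *\<^sub>R offset T 4" for k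
    by (simp add: offset_def)
  then show ?thesis
    unfolding signed_volume_def by (simp only: triple_product_rescaled_differences[OF offset_4]) simp
qed

text \<open>The parallel axis theorem for points at distance \<open>1\<close> from the origin. Its two uses: the centroid is
  inside the sphere, and the mean of the squared offsets is \<open>1 - |G|\<^sup>2\<close>.\<close>

lemma sum_norm_offset:
  assumes "T \<in> sphere_quadruples"
  shows "(\<Sum>k\<in>UNIV. (norm (offset T k))\<^sup>2) = 4 * (1 - (norm (centroid T))\<^sup>2)"
proof -
  have TT: "T $ k \<bullet> T $ k = 1" for k
    using assms by (simp add: sphere_quadruples_def norm_eq_1)
  have "(\<Sum>k\<in>UNIV. (norm (offset T k))\<^sup>2)
      = (\<Sum>k\<in>UNIV. 1 - 2 * (T $ k \<bullet> centroid T) + centroid T \<bullet> centroid T)"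
    by (intro sum.cong)
      (auto simp: power2_norm_eq_inner offset_def inner_diff_left inner_diff_right TT inner_commute)
  also have "\<dots> = 4 - 2 * ((\<Sum>k\<in>UNIV. T $ k) \<bullet> centroid T) + 4 * (centroid T \<bullet> centroid T)"
    by (simp add: sum_4 inner_add_left)
  also have "(\<Sum>k\<in>UNIV. T $ k) = 4 *\<^sub>R centroid T"
    by (simp add: centroid_def)
  finally show ?thesis by (simp add: power2_norm_eq_inner)
qed

lemma norm_centroid_less_1:
  assumes "T \<in> sphere_quadruples" "signed_volume T \<noteq> 0"
  shows "norm (centroid T) < 1"
proof -
  have "offset T 1 \<noteq> 0"
    using assms(2) by (auto simp: signed_volume_offset)
  then have "0 < (norm (offset T 1))\<^sup>2" by simp
  also have "\<dots> \<le> (\<Sum>k\<in>UNIV. (norm (offset T k))\<^sup>2)"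
    by (intro member_le_sum) auto
  finally have "(norm (centroid T))\<^sup>2 < 1"
    using sum_norm_offset[OF assms(1)] by simp
  then show ?thesis by (simp add: power_less_one_iff abs_square_less_1)
qed

lemma offset_nonzero:
  assumes "T \<in> sphere_quadruples" "signed_volume T \<noteq> 0"
  shows "offset T k \<noteq> 0"
proof -
  have "norm (T $ k) = 1"
    using assms(1) by (simp add: sphere_quadruples_def)
  then show ?thesis
    using norm_centroid_less_1[OF assms] by (auto simp: offset_def)
qed

lemma step_well_definedI:
  assumes "T \<in> sphere_quadruples" "signed_volume T \<noteq> 0"
  shows "step_well_defined T"
  unfolding step_well_defined_def
proof
  fix k
  have "norm (T $ k) = 1"
    using assms(1) by (simp add: sphere_quadruples_def)
  then show "centroid T \<noteq> T $ k \<and> (\<exists>!X. is_second_intersection (centroid T) (T $ k) X)"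
    using offset_nonzero[OF assms, of k]
    by (simp add: is_second_intersection_iff[OF _ norm_centroid_less_1[OF assms]] offset_def)
qed

lemma is_second_intersection_step:
  assumes "T \<in> sphere_quadruples" "signed_volume T \<noteq> 0"
  shows "is_second_intersection (centroid T) (T $ k) (step T $ k)"
proof -
  have "\<exists>!X. is_second_intersection (centroid T) (T $ k) X"
    using step_well_definedI[OF assms] by (simp add: step_well_defined_def)
  from theI'[OF this] show ?thesis
    by (simp add: step_def second_intersection_def)
qed

lemma step_in_sphere_quadruples:
  assumes "T \<in> sphere_quadruples" "signed_volume T \<noteq> 0"
  shows "step T \<in> sphere_quadruples"
  using is_second_intersection_step[OF assms]
  by (auto simp: sphere_quadruples_def is_second_intersection_def)

definition line_projection :: "'a::real_inner \<Rightarrow> 'a \<Rightarrow> 'a" where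
  "line_projection d u = ((u \<bullet> d) / (d \<bullet> d)) *\<^sub>R d"

lemma step_nth:
  assumes "T \<in> sphere_quadruples" "signed_volume T \<noteq> 0"
  shows "step T $ k = T $ k - 2 *\<^sub>R line_projection (offset T k) (T $ k)"
  using is_second_intersection_step[OF assms, of k] assms(1)
  by (simp add: is_second_intersection_iff[OF _ norm_centroid_less_1[OF assms]]
      sphere_quadruples_def offset_def line_projection_def)

text \<open>Up to twice the part of the centroid orthogonal to the offset, a step is the antipodal map.
  The reflection formula is applied to \<open>A\<^sub>k = d\<^sub>k + G\<close>, where the projection fixes \<open>d\<^sub>k\<close>.\<close>

lemma step_add_self:
  assumes "T \<in> sphere_quadruples" "signed_volume T \<noteq> 0"
  shows "step T $ k + T $ k = 2 *\<^sub>R (centroid T - line_projection (offset T k) (centroid T))"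
proof -
  have "T $ k = offset T k + centroid T" by (simp add: offset_def)
  then have "line_projection (offset T k) (T $ k) = offset T k + line_projection (offset T k) (centroid T)"
    using offset_nonzero[OF assms, of k]
    by (simp add: line_projection_def inner_add_left add_divide_distrib scaleR_add_left)
  then show ?thesis
    unfolding step_nth[OF assms] by (simp add: offset_def scaleR_2)
qed

lemma centroid_step:
  assumes "T \<in> sphere_quadruples" "signed_volume T \<noteq> 0"
  shows "centroid (step T)
    = centroid T - (1 / 2) *\<^sub>R (\<Sum>k\<in>UNIV. line_projection (offset T k) (centroid T))"
proof -
  have "step T $ k = 2 *\<^sub>R centroid T - 2 *\<^sub>R line_projection (offset T k) (centroid T) - T $ k" for k
    using step_add_self[OF assms, of k] by (simp add: algebra_simps)
  then have "(\<Sum>k\<in>UNIV. step T $ k) = 8 *\<^sub>R centroid T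
      - 2 *\<^sub>R (\<Sum>k\<in>UNIV. line_projection (offset T k) (centroid T)) - (\<Sum>k\<in>UNIV. T $ k)"
    by (simp add: sum_subtractf scaleR_sum_right)
  also have "(\<Sum>k\<in>UNIV. T $ k) = 4 *\<^sub>R centroid T"
    by (simp add: centroid_def)
  also have "8 *\<^sub>R centroid T - p - 4 *\<^sub>R centroid T = 4 *\<^sub>R centroid T - p" for p
    by (simp add: vec_eq_iff)
  finally show ?thesis
    unfolding centroid_def[of "step T"] by (simp add: scaleR_diff_right)
qed

text \<open>Seen from the centroid, a step reverses each offset and inverts its length, as the power of the
  centroid with respect to the sphere requires.\<close>

lemma step_minus_centroid:
  assumes "T \<in> sphere_quadruples" "signed_volume T \<noteq> 0"
  shows "step T $ k - centroid T
    = - ((1 - (norm (centroid T))\<^sup>2) / (norm (offset T k))\<^sup>2) *\<^sub>R offset T k"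
proof -
  let ?d = "offset T k" and ?G = "centroid T"
  have TT: "T $ k \<bullet> T $ k = 1"
    using assms(1) by (simp add: sphere_quadruples_def norm_eq_1)
  have d0: "?d \<bullet> ?d \<noteq> 0" using offset_nonzero[OF assms] by simp
  have e: "?d \<bullet> ?d - 2 * (T $ k \<bullet> ?d) = ?G \<bullet> ?G - 1"
    by (simp add: offset_def inner_diff_left inner_diff_right inner_commute TT)
  have "step T $ k - ?G = ?d - (2 * (T $ k \<bullet> ?d) / (?d \<bullet> ?d)) *\<^sub>R ?d"
    unfolding step_nth[OF assms] by (simp add: line_projection_def offset_def)
  also have "\<dots> = ((?d \<bullet> ?d - 2 * (T $ k \<bullet> ?d)) / (?d \<bullet> ?d)) *\<^sub>R ?d"
    using d0 by (simp add: diff_divide_distrib scaleR_diff_left)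
  also have "\<dots> = - ((1 - (norm ?G)\<^sup>2) / (norm ?d)\<^sup>2) *\<^sub>R ?d"
    unfolding e by (simp add: power2_norm_eq_inner minus_divide_left)
  finally show ?thesis .
qed

section \<open>The volume does not decrease\<close>

lemma prod_4: "prod f (UNIV :: 4 set) = f 1 * f 2 * f 3 * f 4"
  unfolding UNIV_4 by (simp add: ac_simps)

lemma arith_geo_mean_4:
  fixes a b c d :: real
  assumes "a \<ge> 0" "b \<ge> 0" "c \<ge> 0" "d \<ge> 0"
  shows "a * b * c * d \<le> ((a + b + c + d) / 4) ^ 4"
proof -
  have am: "x * y \<le> ((x + y) / 2)\<^sup>2" for x y :: real
    using sum_squares_bound[of x y] by (simp add: power2_eq_square field_simps)
  have "(a * b) * (c * d) \<le> ((a + b) / 2)\<^sup>2 * ((c + d) / 2)\<^sup>2"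
    using assms by (intro mult_mono am) auto
  also have "\<dots> = (((a + b) / 2) * ((c + d) / 2))\<^sup>2"
    by (rule power_mult_distrib[symmetric])
  also have "\<dots> \<le> ((((a + b) / 2 + (c + d) / 2) / 2)\<^sup>2)\<^sup>2"
    using assms by (intro power_mono am) auto
  also have "\<dots> = ((a + b + c + d) / 4) ^ 4"
    by (simp add: add_divide_distrib add.assoc flip: power_mult)
  finally show ?thesis by (simp add: mult_ac)
qed

text \<open>With factors \<open>s\<^sub>k = - p / r\<^sub>k\<close>, where \<open>r\<^sub>k\<close> is the squared offset, the sum of the products of three
  of the \<open>s\<^sub>k\<close> is their full product times \<open>\<Sum> 1 / s\<^sub>k = - (\<Sum> r\<^sub>k) / p = - 4\<close>.\<close>

lemma signed_volume_step:
  assumes "T \<in> sphere_quadruples" "signed_volume T \<noteq> 0"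
  shows "signed_volume (step T) = - ((1 - (norm (centroid T))\<^sup>2) ^ 4
      / (\<Prod>k\<in>UNIV. (norm (offset T k))\<^sup>2)) * signed_volume T"
proof -
  define p where "p = 1 - (norm (centroid T))\<^sup>2"
  define r where "r k = (norm (offset T k))\<^sup>2" for k
  have r0: "r k \<noteq> 0" for k using offset_nonzero[OF assms] by (simp add: r_def)
  have sr: "r 1 + r 2 + r 3 + r 4 = 4 * p"
    using sum_norm_offset[OF assms(1)] by (simp add: sum_4 r_def p_def)
  have diff: "step T $ k - step T $ 4 = (- p / r k) *\<^sub>R offset T k - (- p / r 4) *\<^sub>R offset T 4" for k
  proof -
    have "step T $ k - step T $ 4 = (step T $ k - centroid T) - (step T $ 4 - centroid T)"
      by simp
    then show ?thesis
      unfolding step_minus_centroid[OF assms] by (simp only: p_def r_def minus_divide_left)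
  qed
  have "signed_volume (step T) = - (p ^ 3 * (r 1 + r 2 + r 3 + r 4) / (r 1 * r 2 * r 3 * r 4))
      * (offset T 1 \<bullet> cross3 (offset T 2) (offset T 3))"
    unfolding signed_volume_def diff triple_product_rescaled_differences[OF offset_4]
    using r0 by (simp add: field_simps power3_eq_cube)
  also have "\<dots> = - (p ^ 4 / (r 1 * r 2 * r 3 * r 4)) * signed_volume T"
    unfolding sr signed_volume_offset by (simp add: power4_eq_xxxx power3_eq_cube)
  finally show ?thesis by (simp add: p_def r_def prod_4)
qed

lemma abs_signed_volume_step:
  assumes "T \<in> sphere_quadruples" "signed_volume T \<noteq> 0"
  shows "\<bar>signed_volume T\<bar> \<le> \<bar>signed_volume (step T)\<bar>"
proof -
  define P where "P = (\<Prod>k\<in>UNIV. (norm (offset T k))\<^sup>2)"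
  have "P > 0"
    unfolding P_def using offset_nonzero[OF assms] by (intro prod_pos) auto
  have "P = (norm (offset T 1))\<^sup>2 * (norm (offset T 2))\<^sup>2 * (norm (offset T 3))\<^sup>2 * (norm (offset T 4))\<^sup>2"
    by (simp add: P_def prod_4)
  also have "\<dots> \<le> (((norm (offset T 1))\<^sup>2 + (norm (offset T 2))\<^sup>2
      + (norm (offset T 3))\<^sup>2 + (norm (offset T 4))\<^sup>2) / 4) ^ 4"
    by (rule arith_geo_mean_4) auto
  also have "\<dots> = (1 - (norm (centroid T))\<^sup>2) ^ 4"
    using sum_norm_offset[OF assms(1)] by (simp add: sum_4 diff_divide_distrib)
  finally have "1 \<le> (1 - (norm (centroid T))\<^sup>2) ^ 4 / P"
    using \<open>P > 0\<close> by simp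
  then have "1 \<le> \<bar>(1 - (norm (centroid T))\<^sup>2) ^ 4 / P\<bar>"
    by linarith
  then have "1 * \<bar>signed_volume T\<bar> \<le> \<bar>(1 - (norm (centroid T))\<^sup>2) ^ 4 / P\<bar> * \<bar>signed_volume T\<bar>"
    by (intro mult_right_mono) auto
  then show ?thesis
    unfolding signed_volume_step[OF assms] P_def[symmetric] abs_mult abs_minus_cancel by simp
qed

section \<open>The centroid contracts\<close>

lemma norm_diff_projection_le: "norm (u - line_projection d u) \<le> norm u"
proof (cases "d = 0")
  case False
  have "(u - line_projection d u) \<bullet> (u - line_projection d u) = u \<bullet> u - (u \<bullet> d)\<^sup>2 / (d \<bullet> d)"
    using False by (simp add: line_projection_def inner_diff_left inner_diff_right inner_commute
        power2_eq_square field_simps)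
  also have "\<dots> \<le> u \<bullet> u" by simp
  finally show ?thesis by (simp add: norm_le)
qed (simp add: line_projection_def)

text \<open>The defect in the inequality \<open>|a + b + c + d|\<^sup>2 \<le> 4 (|a|\<^sup>2 + |b|\<^sup>2 + |c|\<^sup>2 + |d|\<^sup>2)\<close>. It shows that equality
  needs four equal vectors.\<close>

lemma four_vectors_cauchy_defect:
  fixes a b c d :: "'a::real_inner"
  shows "4 * (a \<bullet> a + b \<bullet> b + c \<bullet> c + d \<bullet> d) - (a + b + c + d) \<bullet> (a + b + c + d)
    = (a - b) \<bullet> (a - b) + (a - c) \<bullet> (a - c) + (a - d) \<bullet> (a - d)
      + (b - c) \<bullet> (b - c) + (b - d) \<bullet> (b - d) + (c - d) \<bullet> (c - d)"
  by (simp add: inner_diff_left inner_diff_right inner_add_left inner_add_right inner_commute)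

text \<open>For the projections \<open>x\<^sub>k\<close> of \<open>u\<close> one has \<open>u \<bullet> x\<^sub>k = |x\<^sub>k|\<^sup>2\<close>, hence
  \<open>|u - (1/2) \<Sum> x\<^sub>k|\<^sup>2 = |u|\<^sup>2 - (\<Sum> |x\<^sub>k|\<^sup>2 - (1/4) |\<Sum> x\<^sub>k|\<^sup>2)\<close>. The bracket is nonnegative, and it vanishes
  only if all \<open>x\<^sub>k\<close> coincide. If the common value is \<open>0\<close>, then all offsets are orthogonal to \<open>u\<close>;
  otherwise they are all parallel to that value. In both cases the tetrahedron is flat.\<close>

lemma norm_diff_half_sum_projections_less:
  assumes T: "T \<in> sphere_quadruples" "signed_volume T \<noteq> 0" and "u \<noteq> 0"
  shows "norm (u - (1 / 2) *\<^sub>R (\<Sum>k\<in>UNIV. line_projection (offset T k) u)) < norm u"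
proof (rule ccontr)
  define x where "x k = line_projection (offset T k) u" for k
  assume "\<not> ?thesis"
  then have ge: "u \<bullet> u \<le> (u - (1 / 2) *\<^sub>R (\<Sum>k\<in>UNIV. x k)) \<bullet> (u - (1 / 2) *\<^sub>R (\<Sum>k\<in>UNIV. x k))"
    by (simp add: norm_le x_def not_less)
  have ux: "u \<bullet> x k = x k \<bullet> x k" for k
    using offset_nonzero[OF T, of k] by (simp add: x_def line_projection_def)
  have "(u - (1 / 2) *\<^sub>R S) \<bullet> (u - (1 / 2) *\<^sub>R S) = u \<bullet> u - u \<bullet> S + (1 / 4) * (S \<bullet> S)" for S
    by (simp add: inner_diff_left inner_diff_right inner_commute[of S u] field_simps)
  with ge have "u \<bullet> (\<Sum>k\<in>UNIV. x k) \<le> (1 / 4) * ((\<Sum>k\<in>UNIV. x k) \<bullet> (\<Sum>k\<in>UNIV. x k))"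
    by simp
  then have "4 * (\<Sum>k\<in>UNIV. x k \<bullet> x k) \<le> (\<Sum>k\<in>UNIV. x k) \<bullet> (\<Sum>k\<in>UNIV. x k)"
    by (simp add: inner_sum_right ux)
  then have "(x 1 - x 2) \<bullet> (x 1 - x 2) + (x 1 - x 3) \<bullet> (x 1 - x 3)
      + (x 1 - x 4) \<bullet> (x 1 - x 4) + (x 2 - x 3) \<bullet> (x 2 - x 3)
      + (x 2 - x 4) \<bullet> (x 2 - x 4) + (x 3 - x 4) \<bullet> (x 3 - x 4) \<le> 0"
    unfolding sum_4 four_vectors_cauchy_defect[symmetric] by linarith
  moreover have "0 \<le> (x i - x j) \<bullet> (x i - x j)" for i j
    by simp
  ultimately have "(x 1 - x 2) \<bullet> (x 1 - x 2) = 0" "(x 1 - x 3) \<bullet> (x 1 - x 3) = 0"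
    by (smt (verit))+
  then have eq: "x 2 = x 1" "x 3 = x 1" by auto
  show False
  proof (cases "x 1 = 0")
    case True
    then have "u \<bullet> offset T 1 = 0" "u \<bullet> offset T 2 = 0" "u \<bullet> offset T 3 = 0"
      using eq offset_nonzero[OF T] by (auto simp: x_def line_projection_def)
    then show False
      using orthogonal_to_triple_imp_0 T(2) \<open>u \<noteq> 0\<close> by (auto simp: signed_volume_offset)
  next
    case False
    have "\<exists>c. offset T k = c *\<^sub>R x 1" if "x k = x 1" for k
      using that False unfolding x_def[of k] line_projection_def
      by (metis divideR_right scaleR_zero_left)
    then obtain a b where "offset T 2 = a *\<^sub>R x 1" "offset T 3 = b *\<^sub>R x 1"
      using eq by metis
    then have "signed_volume T = 0"
      by (simp add: signed_volume_offset cross_mult_left cross_mult_right)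
    with T(2) show False ..
  qed
qed

definition volume_at_least :: "real \<Rightarrow> quadruple set" where
  "volume_at_least c = {T \<in> sphere_quadruples. c \<le> \<bar>signed_volume T\<bar>}"

lemma continuous_on_signed_volume: "continuous_on S signed_volume"
  unfolding signed_volume_def cross3_def inner_vec_def sum_3 vector_3
  by (intro continuous_intros)

lemma continuous_on_centroid: "continuous_on S centroid"
  unfolding centroid_def by (intro continuous_intros)

lemma compact_volume_at_least: "compact (volume_at_least c)"
proof -
  have "volume_at_least c = {T. (\<forall>k. norm (T $ k) = 1) \<and> c \<le> \<bar>signed_volume T\<bar>}"
    by (auto simp: volume_at_least_def sphere_quadruples_def)
  also have "closed \<dots>"
    by (intro closed_Collect_conj closed_Collect_all closed_Collect_eq closed_Collect_le
        continuous_intros continuous_on_signed_volume)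
  finally have "closed (volume_at_least c)" .
  moreover have "bounded (volume_at_least c)"
  proof (rule boundedI)
    fix T assume "T \<in> volume_at_least c"
    then have "(\<Sum>k\<in>UNIV. norm (T $ k)) = 4"
      by (simp add: volume_at_least_def sphere_quadruples_def)
    moreover have "norm T \<le> (\<Sum>k\<in>UNIV. norm (T $ k))"
      unfolding norm_vec_def by (rule L2_set_le_sum) simp
    ultimately show "norm T \<le> 4" by simp
  qed
  ultimately show ?thesis by (simp add: compact_eq_bounded_closed)
qed

text \<open>By compactness the strict inequality \<open>norm_diff_half_sum_projections_less\<close>, taken over all directions
  \<open>u\<close> and all quadruples of volume bounded below, holds with one factor below \<open>1\<close>.\<close>

lemma centroid_contraction:
  assumes "c > 0"
  obtains q where "0 < q" "q < 1"
    "\<And>T. T \<in> volume_at_least c \<Longrightarrow> norm (centroid (step T)) \<le> q * norm (centroid T)"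
proof -
  define f where "f = (\<lambda>(T, u). norm (u - (1 / 2) *\<^sub>R (\<Sum>k\<in>UNIV. line_projection (offset T k) u)))"
  define D where "D = volume_at_least c \<times> unit_sphere"
  have good: "T \<in> sphere_quadruples" "signed_volume T \<noteq> 0" if "T \<in> volume_at_least c" for T
    using that assms by (auto simp: volume_at_least_def)
  have less: "f z < 1" if "z \<in> D" for z
  proof -
    obtain T u where z: "z = (T, u)" "T \<in> volume_at_least c" "norm u = 1"
      using \<open>z \<in> D\<close> by (auto simp: D_def)
    moreover have "u \<noteq> 0" using z(3) by auto
    ultimately show ?thesis
      using norm_diff_half_sum_projections_less[OF good[OF z(2)], of u] by (simp add: f_def)
  qed
  have cont: "continuous_on D f"
    unfolding f_def D_def line_projection_def case_prod_beta offset_def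
    by (intro continuous_intros continuous_on_compose2[OF continuous_on_centroid[of UNIV]])
      (use offset_nonzero[OF good] in \<open>auto simp: offset_def\<close>)
  have "compact D"
    unfolding D_def by (intro compact_Times compact_volume_at_least compact_sphere)
  obtain m where m: "m < 1" "\<And>z. z \<in> D \<Longrightarrow> f z \<le> m"
  proof (cases "D = {}")
    case False
    then show ?thesis
      using continuous_attains_sup[OF \<open>compact D\<close> False cont] less that by metis
  qed (use that[of 0] in auto)
  \<comment> \<open>The maximum with \<open>1 / 2\<close> keeps the factor positive, since \<open>m\<close> may be \<open>0\<close>.\<close>
  define q where "q = max m (1 / 2)"
  show ?thesis
  proof (rule that)
    show "0 < q" "q < 1" using m by (auto simp: q_def)
    fix T assume T: "T \<in> volume_at_least c"
    show "norm (centroid (step T)) \<le> q * norm (centroid T)"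
    proof (cases "centroid T = 0")
      case True
      then show ?thesis
        unfolding centroid_step[OF good[OF T]] by (simp add: line_projection_def)
    next
      case False
      define u where "u = centroid T /\<^sub>R norm (centroid T)"
      have G: "centroid T = norm (centroid T) *\<^sub>R u"
        using False by (simp add: u_def)
      have lin: "line_projection d (s *\<^sub>R v) = s *\<^sub>R line_projection d v" for d v :: point and s
        by (simp add: line_projection_def)
      have "centroid (step T) = norm (centroid T) *\<^sub>R (u - (1 / 2) *\<^sub>R (\<Sum>k\<in>UNIV. line_projection (offset T k) u))"
        unfolding centroid_step[OF good[OF T]]
        by (subst (1 2) G) (simp add: lin scaleR_diff_right scaleR_sum_right mult.commute)
      then have "norm (centroid (step T)) = norm (centroid T) * f (T, u)"
        by (simp add: f_def)
      also have "\<dots> \<le> norm (centroid T) * q"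
        using m(2)[of "(T, u)"] T False by (intro mult_left_mono) (auto simp: D_def q_def u_def)
      finally show ?thesis by (simp add: mult.commute)
    qed
  qed
qed

section \<open>Limits\<close>

lemma isosceles_if_centroid_0:
  assumes T: "T \<in> sphere_quadruples" "signed_volume T \<noteq> 0" and G: "centroid T = 0"
  shows "isosceles T"
proof -
  have TT: "T $ k \<bullet> T $ k = 1" for k
    using T(1) by (simp add: sphere_quadruples_def norm_eq_1)
  have s: "T $ 1 + T $ 2 + T $ 3 + T $ 4 = 0"
    using G by (simp add: centroid_def sum_4)
  have opp: "dist a b = dist c d"
    if "a + b + c + d = 0" "a \<bullet> a = 1" "b \<bullet> b = 1" "c \<bullet> c = 1" "d \<bullet> d = 1" for a b c d :: point
  proof -
    have "a + b = - (c + d)" using that(1) unfolding eq_neg_iff_add_eq_0 by (simp only: add.assoc)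
    then have "(a + b) \<bullet> (a + b) = (c + d) \<bullet> (c + d)"
      by (simp only: inner_minus_left inner_minus_right minus_minus)
    then have "a \<bullet> b = c \<bullet> d"
      using that by (simp add: inner_add_left inner_add_right inner_commute)
    then show ?thesis
      using that by (simp add: dist_norm norm_eq inner_diff_left inner_diff_right inner_commute)
  qed
  have "\<not> coplanar (vertices T)"
    using T(2) signed_volume_0_if_coplanar by blast
  moreover have "dist (T $ 1) (T $ 2) = dist (T $ 3) (T $ 4)"
    using s by (intro opp TT) (simp add: add_ac)
  moreover have "dist (T $ 1) (T $ 3) = dist (T $ 2) (T $ 4)"
    using s by (intro opp TT) (simp add: add_ac)
  moreover have "dist (T $ 1) (T $ 4) = dist (T $ 2) (T $ 3)"
    using s by (intro opp TT) (simp add: add_ac)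
  ultimately show ?thesis by (simp add: isosceles_def)
qed

lemma limit_of_geometric_increments:
  fixes x :: "nat \<Rightarrow> 'a::banach"
  assumes q: "0 < q" "q < 1" and inc: "\<And>n. norm (x (Suc n) - x n) \<le> C * q ^ n"
  obtains l where "\<And>n. norm (x n - l) \<le> C / (1 - q) * q ^ n"
proof -
  have sm: "summable (\<lambda>k. C * q ^ (k + n))" for n
    using q by (simp add: power_add summable_mult summable_mult2 summable_geometric)
  have sums: "(\<lambda>k. C * q ^ (k + n)) sums (C / (1 - q) * q ^ n)" for n
    using sums_mult[OF geometric_sums[of q], of "C * q ^ n"] q
    by (simp add: power_add mult_ac)
  have "summable (\<lambda>k. x (Suc k) - x k)"
    using inc by (intro summable_comparison_test'[OF sm[of 0]]) simp
  from summable_LIMSEQ[OF this] obtain s where "(\<lambda>n. x n - x 0) \<longlonglongrightarrow> s"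
    by (auto simp: sum_lessThan_telescope)
  from tendsto_add[OF this tendsto_const[of "x 0"]] obtain l where l: "x \<longlonglongrightarrow> l"
    by auto
  show ?thesis
  proof (rule that)
    fix n
    have "(\<lambda>k. x (k + n)) \<longlonglongrightarrow> l" using l by (rule LIMSEQ_ignore_initial_segment)
    from telescope_sums[OF this] have "(\<lambda>k. x (Suc k + n) - x (k + n)) sums (l - x n)" by simp
    then have "l - x n = (\<Sum>k. x (Suc k + n) - x (k + n))" by (simp add: sums_iff)
    also have "norm \<dots> \<le> (\<Sum>k. C * q ^ (k + n))"
      using inc by (intro norm_suminf_le sm) simp
    also have "\<dots> = C / (1 - q) * q ^ n" using sums by (simp add: sums_iff)
    finally show "norm (x n - l) \<le> C / (1 - q) * q ^ n" by (simp add: norm_minus_commute)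
  qed
qed

lemma converges_geometricallyI:
  assumes "0 < q" "q < 1" "\<And>i. norm (x i - l) \<le> C * q ^ i"
  shows "converges_geometrically x l"
  unfolding converges_geometrically_def
  using assms by (intro bexI[of _ q] landau_o.bigI[of "\<bar>C\<bar> + 1"])
    (auto intro!: always_eventually intro: order_trans[OF assms(3)] mult_right_mono)

lemma tendsto_if_geometric_bound:
  assumes "0 < q" "q < 1" "\<And>i. norm (x i - l) \<le> C * q ^ i"
  shows "x \<longlonglongrightarrow> l"
proof -
  have "(\<lambda>i. C * q ^ i) \<longlonglongrightarrow> 0"
    using assms(1,2) by (intro tendsto_mult_right_zero LIMSEQ_realpow_zero) auto
  then have "(\<lambda>i. x i - l) \<longlonglongrightarrow> 0"
    using assms(3) by (rule Lim_null_comparison[rotated, OF _ always_eventually[OF allI]])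
  then show ?thesis by (simp add: LIM_zero_iff)
qed

theorem theorem3:
  fixes T0 :: quadruple
  assumes "T0 \<in> sphere_quadruples"
    and "\<not> coplanar (vertices T0)"
  shows "(\<forall>n. iterate T0 n \<in> sphere_quadruples \<and> step_well_defined (iterate T0 n)) \<and>
    (\<exists>L M. L \<in> sphere_quadruples \<and> M \<in> sphere_quadruples \<and>
       isosceles L \<and> isosceles M \<and> (\<forall>k. M $ k = - (L $ k)) \<and>
       (\<lambda>i. iterate T0 (2 * i)) \<longlonglongrightarrow> L \<and>
       (\<lambda>i. iterate T0 (2 * i + 1)) \<longlonglongrightarrow> M \<and>
       converges_geometrically (\<lambda>i. iterate T0 (2 * i)) L \<and>
       converges_geometrically (\<lambda>i. iterate T0 (2 * i + 1)) M)"
proof -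
  define c where "c = \<bar>signed_volume T0\<bar>"
  have "c > 0"
    using coplanar_if_signed_volume_0 assms(2) by (auto simp: c_def)
  then obtain q where q: "0 < q" "q < 1" and contraction:
    "\<And>T. T \<in> volume_at_least c \<Longrightarrow> norm (centroid (step T)) \<le> q * norm (centroid T)"
    using centroid_contraction by metis
  define T where "T = iterate T0"
  have T_0: "T 0 = T0" and T_Suc: "T (Suc n) = step (T n)" for n
    by (simp_all add: T_def iterate_def)
  have good: "S \<in> sphere_quadruples" "signed_volume S \<noteq> 0" if "S \<in> volume_at_least c" for S
    using that \<open>c > 0\<close> by (auto simp: volume_at_least_def)
  have K: "T n \<in> volume_at_least c" for n
  proof (induction n)
    case 0
    show ?case using assms(1) by (simp add: T_0 volume_at_least_def c_def)
  next
    case (Suc n)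
    have "c \<le> \<bar>signed_volume (T n)\<bar>"
      using Suc by (simp add: volume_at_least_def)
    then show ?case
      using abs_signed_volume_step[OF good[OF Suc]] step_in_sphere_quadruples[OF good[OF Suc]]
      by (simp add: T_Suc volume_at_least_def)
  qed
  have G: "norm (centroid (T n)) \<le> q ^ n" for n
  proof (induction n)
    case 0
    show ?case using norm_centroid_less_1[OF good[OF K]] by (simp add: less_imp_le)
  next
    case (Suc n)
    have "norm (centroid (T (Suc n))) \<le> q * norm (centroid (T n))"
      unfolding T_Suc by (rule contraction[OF K])
    also have "\<dots> \<le> q * q ^ n" using Suc q by (intro mult_left_mono) auto
    finally show ?case by simp
  qed
  \<comment> \<open>A step is nearly the antipodal map, so the alternating sign turns the sequence with two limit
    points into a convergent one.\<close>
  define B where "B n = (- 1) ^ n *\<^sub>R T n" for n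
  have inc: "norm (B (Suc n) - B n) \<le> 8 * q ^ n" for n
  proof -
    have "B (Suc n) - B n = (- 1) ^ Suc n *\<^sub>R (T (Suc n) + T n)"
      by (simp add: B_def scaleR_add_right)
    then have "norm (B (Suc n) - B n) = norm (T (Suc n) + T n)"
      by (simp add: power_abs)
    also have "\<dots> \<le> (\<Sum>k\<in>UNIV. norm ((T (Suc n) + T n) $ k))"
      unfolding norm_vec_def by (rule L2_set_le_sum) simp
    also have "\<dots> \<le> (\<Sum>k\<in>(UNIV :: 4 set). 2 * q ^ n)"
    proof (rule sum_mono)
      fix k :: 4
      have "norm ((T (Suc n) + T n) $ k)
          = 2 * norm (centroid (T n) - line_projection (offset (T n) k) (centroid (T n)))"
        using step_add_self[OF good[OF K], of n k] by (simp add: T_Suc)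
      also have "\<dots> \<le> 2 * q ^ n"
        using order_trans[OF norm_diff_projection_le G] by simp
      finally show "norm ((T (Suc n) + T n) $ k) \<le> 2 * q ^ n" .
    qed
    also have "\<dots> = 8 * q ^ n" by simp
    finally show ?thesis .
  qed
  obtain L where L: "\<And>n. norm (B n - L) \<le> 8 / (1 - q) * q ^ n"
    using limit_of_geometric_increments[OF q inc] by blast
  have q2: "0 < q\<^sup>2" "q\<^sup>2 < 1"
    using q by (simp_all add: power_less_one_iff abs_square_less_1)
  have even_bound: "norm (T (2 * i) - L) \<le> 8 / (1 - q) * (q\<^sup>2) ^ i" for i
    using L[of "2 * i"] by (simp add: B_def power_mult)
  have odd_bound: "norm (T (2 * i + 1) - (- L)) \<le> 8 / (1 - q) * q * (q\<^sup>2) ^ i" for i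
  proof -
    have "T (2 * i + 1) - (- L) = - (B (2 * i + 1) - L)"
      by (simp add: B_def power_mult)
    then have "norm (T (2 * i + 1) - (- L)) = norm (B (2 * i + 1) - L)"
      by (simp only: norm_minus_cancel)
    also have "\<dots> \<le> 8 / (1 - q) * q * (q\<^sup>2) ^ i"
      using L[of "2 * i + 1"] by (simp add: mult_ac flip: power_mult)
    finally show ?thesis .
  qed
  have lim_even: "(\<lambda>i. T (2 * i)) \<longlonglongrightarrow> L" and lim_odd: "(\<lambda>i. T (2 * i + 1)) \<longlonglongrightarrow> - L"
    using tendsto_if_geometric_bound[OF q2 even_bound] tendsto_if_geometric_bound[OF q2 odd_bound]
    by this
  have closed: "closed (volume_at_least c)"
    by (intro compact_imp_closed compact_volume_at_least)
  have LK: "L \<in> volume_at_least c" "- L \<in> volume_at_least c"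
    using closed_sequentially[OF closed _ lim_even] closed_sequentially[OF closed _ lim_odd] K
    by blast+
  have "(\<lambda>i. centroid (T (2 * i))) \<longlonglongrightarrow> centroid L"
    by (rule continuous_on_tendsto_compose[OF continuous_on_centroid[of UNIV] lim_even]) auto
  moreover have "(\<lambda>i. centroid (T (2 * i))) \<longlonglongrightarrow> 0"
    using G[of "2 * _"] by (intro tendsto_if_geometric_bound[OF q2, of _ _ 1]) (simp add: power_mult)
  ultimately have GL: "centroid L = 0"
    using LIMSEQ_unique by blast
  then have GM: "centroid (- L) = 0"
    by (simp add: centroid_def sum_negf)
  have "isosceles L" "isosceles (- L)"
    using isosceles_if_centroid_0[OF good] LK GL GM by blast+
  moreover have "converges_geometrically (\<lambda>i. T (2 * i)) L"
    "converges_geometrically (\<lambda>i. T (2 * i + 1)) (- L)"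
    using converges_geometricallyI[OF q2 even_bound] converges_geometricallyI[OF q2 odd_bound]
    by this
  moreover have "T n \<in> sphere_quadruples \<and> step_well_defined (T n)" for n
    using good[OF K] step_well_definedI by blast
  ultimately show ?thesis
    unfolding T_def[symmetric] using good(1) LK lim_even lim_odd
    by (intro conjI allI exI[of _ L] exI[of _ "- L"]) auto
qed

end
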